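(* Let $(M^2,[\nabla])$ be a smooth projective surface with fixed volume form $\epsilon$, let $\nabla\in[\nabla]$ be the connection with $\nabla_a\epsilon_{bc}=0$, and let $\mathrm{P}_{ab}$, $Y_a$, $Y^a$, $\phi$, $W^a$, $\rho$ be as defined in the context. Assume that $Y_a$ is nowhere zero and that $\rho=0$ identically on $M$, and let $k,m$ be the functions defined in the context. Suppose $M$ admits a solution $\alpha_a$ of the pEW equation $\nabla_{(a}\alpha_{b)}+\alpha_a\alpha_b+\mathrm{P}_{(ab)}=0$. Then $$k\,Y^a\nabla_am-m\left(Y^a\nabla_ak+k\phi-6m\right)=0$$ on $M$.
   Context: Abstract index notation is used; round and square brackets on indices denote symmetrization and skew-symmetrization with factor $1/2$. Everything is smooth. A projective structure $[\nabla]$ on a manifold $M$ is an equivalence class of torsion-free affine connections having the same unparametrized geodesics; equivalently, $\hat\nabla$ and $\nabla$ are projectively equivalent iff $\hat\nabla_a\omega_b=\nabla_a\omega_b-\Upsilon_a\omega_b-\Upsilon_b\omega_a$ for some 1-form $\Upsilon_a$. A projective surface is a 2-dimensional manifold with a projective structure. The curvature is $(\nabla_a\nabla_b-\nabla_b\nabla_a)X^c=R_{ab}{}^c{}_dX^d$, the Ricci tensor is $R_{ab}=R_{ca}{}^c{}_b$, and in dimension $n$ the projective rho tensor is $\mathrm{P}_{ab}=\frac{n}{n^2-1}R_{ab}+\frac{1}{n^2-1}R_{ba}$ (here $n=2$). A volume form $\epsilon_{ab}$ on $M$ is fixed, with inverse $\epsilon^{ab}$ normalized by $\epsilon^{ab}\epsilon_{ab}=2$,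 $\epsilon^{ac}\epsilon_{bc}=\delta^a{}_b$. The connection $\nabla\in[\nabla]$ is chosen so that $\nabla_a\epsilon_{bc}=0$; then $\mathrm{P}_{ab}$ is symmetric. Indices are raised and lowered by $V^a=\epsilon^{ab}V_b$, $V_b=V^a\epsilon_{ab}$. The Cotton-York tensor is $Y_{abc}=\nabla_a\mathrm{P}_{bc}-\nabla_b\mathrm{P}_{ac}$, and $Y_a:=\epsilon^{bc}Y_{bca}$, so $Y_{abc}=\frac12\epsilon_{ab}Y_c$. Define $$\phi=2\nabla_aY^a,\qquad W^a=Y^b\nabla_bY^a-\frac{2\phi}{3}Y^a,\qquad \rho=Y_aW^a,\qquad \ell=\frac{5\phi^2}{12}+3\mathrm{P}_{ac}Y^aY^c-\frac{Y^a\nabla_a\phi}{2}.$$ When $\rho=0$ and $Y_a$ is nowhere zero, $W^a$ and $Y^a$ are linearly dependent everywhere, and $f$ denotes the function with $W^a=fY^a$. Set $$h=\ell+\frac{f\phi}{2},\qquad k=3\phi f-3Y^a\nabla_af+12h+\frac{18}{5}f^2,\qquad m=\frac{6hf}{5}-Y^a\nabla_ah+2\phi h .$$ The projective Einstein-Weyl (pEW) equation for a 1-form $\alpha_a$ on $M$ is $\nabla_{(a}\alpha_{b)}+\alpha_a\alpha_b+\mathrm{P}_{(ab)}=0$; it expresses that some connection in $[\nabla]$ has skew-symmetric Ricci tensor. *)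

theory Defs
  imports "HOL-Analysis.Analysis"
begin

section \<open>Smooth manifolds\<close>

definition partial_deriv :: "'n::finite \<Rightarrow> (real^'n \<Rightarrow> real) \<Rightarrow> real^'n \<Rightarrow> real" where
  "partial_deriv i f x = frechet_derivative f (at x) (axis i 1)"

text \<open>For open \<open>S\<close>: \<open>f\<close> is \<open>C\<^sup>\<infinity>\<close> on \<open>S\<close>.\<close>

definition smooth_on :: "(real^'n) set \<Rightarrow> (real^'n::finite \<Rightarrow> real) \<Rightarrow> bool" where
  "smooth_on S f \<longleftrightarrow> (\<forall>is. \<forall>x\<in>S. foldr partial_deriv is f differentiable (at x))"

datatype ('a, 'n::finite) chart = Chart (domain: "'a set") (coord: "'a \<Rightarrow> real^'n")

definition param :: "('a, 'n::finite) chart \<Rightarrow> real^'n \<Rightarrow> 'a" where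
  "param c = inv_into (domain c) (coord c)"

definition smooth_manifold :: "'a topology \<Rightarrow> ('a, 'n::finite) chart set \<Rightarrow> bool" where
  "smooth_manifold M A \<longleftrightarrow>
     Hausdorff_space M \<and> second_countable M \<and> (\<Union>c\<in>A. domain c) = topspace M \<and>
     (\<forall>c\<in>A. openin M (domain c) \<and> open (coord c ` domain c) \<and>
        homeomorphic_map (subtopology M (domain c)) (top_of_set (coord c ` domain c)) (coord c)) \<and>
     (\<forall>c\<in>A. \<forall>c'\<in>A. \<forall>i.
        smooth_on (coord c ` (domain c \<inter> domain c')) (\<lambda>x. coord c' (param c x) $ i))"

definition smooth_in :: "('a, 'n::finite) chart \<Rightarrow> ('a \<Rightarrow> real) \<Rightarrow> bool" where
  "smooth_in c F \<longleftrightarrow> smooth_on (coord c ` domain c) (F \<circ> param c)"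

definition pd :: "('a, 'n::finite) chart \<Rightarrow> 'n \<Rightarrow> ('a \<Rightarrow> real) \<Rightarrow> 'a \<Rightarrow> real" where
  "pd c i F p = partial_deriv i (F \<circ> param c) (coord c p)"

text \<open>\<open>jac c c' j i\<close> is the partial derivative of the \<open>j\<close>-th coordinate of \<open>c'\<close> with respect
  to the \<open>i\<close>-th coordinate of \<open>c\<close>.\<close>

definition jac :: "('a, 'n::finite) chart \<Rightarrow> ('a, 'n) chart \<Rightarrow> 'n \<Rightarrow> 'n \<Rightarrow> 'a \<Rightarrow> real" where
  "jac c c' j i = pd c i (\<lambda>q. coord c' q $ j)"


section \<open>Tensor fields and affine connections\<close>

text \<open>A tensor field is given by its components in each chart, as functions of the point of the
  manifold. Only the values at charts \<open>c\<close> of the atlas and points of \<open>domain c\<close> are meaningful.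
  Objects derived from tensor fields and connections, including scalars, are likewise indexed by
  the chart in which they are computed.\<close>

type_synonym ('a, 'n) scalar = "('a, 'n) chart \<Rightarrow> 'a \<Rightarrow> real"
type_synonym ('a, 'n) tensor1 = "('a, 'n) chart \<Rightarrow> 'n \<Rightarrow> 'a \<Rightarrow> real"
type_synonym ('a, 'n) tensor2 = "('a, 'n) chart \<Rightarrow> 'n \<Rightarrow> 'n \<Rightarrow> 'a \<Rightarrow> real"
type_synonym ('a, 'n) tensor3 = "('a, 'n) chart \<Rightarrow> 'n \<Rightarrow> 'n \<Rightarrow> 'n \<Rightarrow> 'a \<Rightarrow> real"

definition one_form :: "('a, 'n::finite) chart set \<Rightarrow> ('a, 'n) tensor1 \<Rightarrow> bool" where
  "one_form A \<omega> \<longleftrightarrow>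
     (\<forall>c\<in>A. \<forall>a. smooth_in c (\<omega> c a)) \<and>
     (\<forall>c\<in>A. \<forall>c'\<in>A. \<forall>p\<in>domain c \<inter> domain c'. \<forall>a.
        \<omega> c a p = (\<Sum>i\<in>UNIV. jac c c' i a p * \<omega> c' i p))"

definition two_form :: "('a, 'n::finite) chart set \<Rightarrow> ('a, 'n) tensor2 \<Rightarrow> bool" where
  "two_form A \<omega> \<longleftrightarrow>
     (\<forall>c\<in>A. \<forall>a b. smooth_in c (\<omega> c a b)) \<and>
     (\<forall>c\<in>A. \<forall>p\<in>domain c. \<forall>a b. \<omega> c a b p = - \<omega> c b a p) \<and>
     (\<forall>c\<in>A. \<forall>c'\<in>A. \<forall>p\<in>domain c \<inter> domain c'. \<forall>a b.
        \<omega> c a b p = (\<Sum>i\<in>UNIV. \<Sum>j\<in>UNIV. jac c c' i a p * jac c c' j b p * \<omega> c' i j p))"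

definition volume_form :: "('a, 2) chart set \<Rightarrow> ('a, 2) tensor2 \<Rightarrow> bool" where
  "volume_form A \<epsilon> \<longleftrightarrow> two_form A \<epsilon> \<and> (\<forall>c\<in>A. \<forall>p\<in>domain c. \<exists>a b. \<epsilon> c a b p \<noteq> 0)"

text \<open>\<open>\<Gamma> c e a b\<close> is the Christoffel symbol with upper index \<open>e\<close> and lower indices \<open>a\<close>, \<open>b\<close>, where
  \<open>a\<close> is the direction of differentiation.\<close>

definition torsion_free_connection ::
    "('a, 'n::finite) chart set \<Rightarrow> ('a, 'n) tensor3 \<Rightarrow> bool" where
  "torsion_free_connection A \<Gamma> \<longleftrightarrow>
     (\<forall>c\<in>A. \<forall>e a b. smooth_in c (\<Gamma> c e a b)) \<and>
     (\<forall>c\<in>A. \<forall>c'\<in>A. \<forall>p\<in>domain c \<inter> domain c'. \<forall>e a b.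
        (\<Sum>i\<in>UNIV. jac c c' e i p * \<Gamma> c i a b p) =
          (\<Sum>i\<in>UNIV. \<Sum>j\<in>UNIV. jac c c' i a p * jac c c' j b p * \<Gamma> c' e i j p)
          + pd c a (jac c c' e b) p) \<and>
     (\<forall>c\<in>A. \<forall>p\<in>domain c. \<forall>e a b. \<Gamma> c e a b p = \<Gamma> c e b a p)"

text \<open>Covariant derivatives, with the index of differentiation first: \<open>\<nabla>\<^sub>a \<omega>\<^sub>b\<close>, \<open>\<nabla>\<^sub>a X\<^sup>b\<close>,
  \<open>\<nabla>\<^sub>a T\<^sub>b\<^sub>d\<close> and \<open>\<nabla>\<^sub>a T\<^sub>b\<^sup>d\<close>.\<close>

definition nabla_form :: "('a, 'n::finite) tensor3 \<Rightarrow> ('a, 'n) tensor1 \<Rightarrow> ('a, 'n) tensor2" where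
  "nabla_form \<Gamma> \<omega> c a b p = pd c a (\<omega> c b) p - (\<Sum>e\<in>UNIV. \<Gamma> c e a b p * \<omega> c e p)"

definition nabla_vec :: "('a, 'n::finite) tensor3 \<Rightarrow> ('a, 'n) tensor1 \<Rightarrow> ('a, 'n) tensor2" where
  "nabla_vec \<Gamma> X c a b p = pd c a (X c b) p + (\<Sum>e\<in>UNIV. \<Gamma> c b a e p * X c e p)"

definition nabla_cov2 :: "('a, 'n::finite) tensor3 \<Rightarrow> ('a, 'n) tensor2 \<Rightarrow> ('a, 'n) tensor3" where
  "nabla_cov2 \<Gamma> T c a b d p = pd c a (T c b d) p
     - (\<Sum>e\<in>UNIV. \<Gamma> c e a b p * T c e d p) - (\<Sum>e\<in>UNIV. \<Gamma> c e a d p * T c b e p)"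

definition nabla_mixed :: "('a, 'n::finite) tensor3 \<Rightarrow> ('a, 'n) tensor2 \<Rightarrow> ('a, 'n) tensor3" where
  "nabla_mixed \<Gamma> T c a b d p = pd c a (T c b d) p
     - (\<Sum>e\<in>UNIV. \<Gamma> c e a b p * T c e d p) + (\<Sum>e\<in>UNIV. \<Gamma> c d a e p * T c b e p)"

text \<open>The derivative \<open>X\<^sup>a \<nabla>\<^sub>a F\<close> of a scalar.\<close>

definition along :: "('a, 'n::finite) tensor1 \<Rightarrow> ('a, 'n) scalar \<Rightarrow> ('a, 'n) scalar" where
  "along X F c p = (\<Sum>a\<in>UNIV. X c a p * pd c a (F c) p)"


section \<open>Projective structures\<close>

definition projective_rel :: "('a, 'n::finite) chart set \<Rightarrow> ('a, 'n) tensor3 rel" where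
  "projective_rel A = {(\<Gamma>, \<Gamma>').
     torsion_free_connection A \<Gamma> \<and> torsion_free_connection A \<Gamma>' \<and>
     (\<exists>\<Upsilon>. one_form A \<Upsilon> \<and> (\<forall>\<omega>. one_form A \<omega> \<longrightarrow> (\<forall>c\<in>A. \<forall>p\<in>domain c. \<forall>a b.
        nabla_form \<Gamma>' \<omega> c a b p =
          nabla_form \<Gamma> \<omega> c a b p - \<Upsilon> c a p * \<omega> c b p - \<Upsilon> c b p * \<omega> c a p)))}"

definition projective_structure ::
    "('a, 'n::finite) chart set \<Rightarrow> ('a, 'n) tensor3 set \<Rightarrow> bool" where
  "projective_structure A \<P> \<longleftrightarrow> \<P> \<in> {\<Gamma>. torsion_free_connection A \<Gamma>} // projective_rel A"

text \<open>The component \<open>R\<^sub>a\<^sub>b\<^sup>e\<^sub>d\<close>, given by \<open>(\<nabla>\<^sub>a \<nabla>\<^sub>b - \<nabla>\<^sub>b \<nabla>\<^sub>a) X\<^sup>e = R\<^sub>a\<^sub>b\<^sup>e\<^sub>d X\<^sup>d\<close>, is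
  obtained by taking for \<open>X\<close> the \<open>d\<close>-th coordinate vector field.\<close>

definition coord_vec :: "'n \<Rightarrow> ('a, 'n::finite) tensor1" where
  "coord_vec d c b p = (if b = d then 1 else 0)"

definition curvature ::
    "('a, 'n::finite) tensor3 \<Rightarrow> ('a, 'n) chart \<Rightarrow> 'n \<Rightarrow> 'n \<Rightarrow> 'n \<Rightarrow> 'n \<Rightarrow> 'a \<Rightarrow> real" where
  "curvature \<Gamma> c a b e d p =
     nabla_mixed \<Gamma> (nabla_vec \<Gamma> (coord_vec d)) c a b e p
     - nabla_mixed \<Gamma> (nabla_vec \<Gamma> (coord_vec d)) c b a e p"

definition ricci :: "('a, 'n::finite) tensor3 \<Rightarrow> ('a, 'n) tensor2" where
  "ricci \<Gamma> c a b p = (\<Sum>e\<in>UNIV. curvature \<Gamma> c e a e b p)"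

definition rho_tensor :: "('a, 'n::finite) tensor3 \<Rightarrow> ('a, 'n) tensor2" where
  "rho_tensor \<Gamma> c a b p =
     (let n = real CARD('n) in n / (n\<^sup>2 - 1) * ricci \<Gamma> c a b p + 1 / (n\<^sup>2 - 1) * ricci \<Gamma> c b a p)"

definition cotton_york :: "('a, 'n::finite) tensor3 \<Rightarrow> ('a, 'n) tensor3" where
  "cotton_york \<Gamma> c a b d p =
     nabla_cov2 \<Gamma> (rho_tensor \<Gamma>) c a b d p - nabla_cov2 \<Gamma> (rho_tensor \<Gamma>) c b a d p"

definition pEW :: "('a, 'n::finite) chart set \<Rightarrow> ('a, 'n) tensor3 \<Rightarrow> ('a, 'n) tensor1 \<Rightarrow> bool" where
  "pEW A \<Gamma> \<alpha> \<longleftrightarrow> one_form A \<alpha> \<and> (\<forall>c\<in>A. \<forall>p\<in>domain c. \<forall>a b.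
     (nabla_form \<Gamma> \<alpha> c a b p + nabla_form \<Gamma> \<alpha> c b a p) / 2 + \<alpha> c a p * \<alpha> c b p
     + (rho_tensor \<Gamma> c a b p + rho_tensor \<Gamma> c b a p) / 2 = 0)"


section \<open>Invariants of a projective surface with a volume form\<close>

text \<open>The normalization \<open>\<epsilon>\<^sup>a\<^sup>c \<epsilon>\<^sub>b\<^sub>c = \<delta>\<^sup>a\<^sub>b\<close> says that the matrix \<open>\<epsilon>\<^sup>a\<^sup>b\<close> is the inverse of the
  transpose of the matrix \<open>\<epsilon>\<^sub>a\<^sub>b\<close>.\<close>

definition eps_up :: "('a, 2) tensor2 \<Rightarrow> ('a, 2) tensor2" where
  "eps_up \<epsilon> c a b p = matrix_inv (transpose (\<chi> i j. \<epsilon> c i j p)) $ a $ b"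

definition raise :: "('a, 2) tensor2 \<Rightarrow> ('a, 2) tensor1 \<Rightarrow> ('a, 2) tensor1" where
  "raise \<epsilon> V c a p = (\<Sum>b\<in>UNIV. eps_up \<epsilon> c a b p * V c b p)"

definition Y_low :: "('a, 2) tensor3 \<Rightarrow> ('a, 2) tensor2 \<Rightarrow> ('a, 2) tensor1" where
  "Y_low \<Gamma> \<epsilon> c a p = (\<Sum>b\<in>UNIV. \<Sum>d\<in>UNIV. eps_up \<epsilon> c b d p * cotton_york \<Gamma> c b d a p)"

definition Y_up :: "('a, 2) tensor3 \<Rightarrow> ('a, 2) tensor2 \<Rightarrow> ('a, 2) tensor1" where
  "Y_up \<Gamma> \<epsilon> = raise \<epsilon> (Y_low \<Gamma> \<epsilon>)"

definition phi :: "('a, 2) tensor3 \<Rightarrow> ('a, 2) tensor2 \<Rightarrow> ('a, 2) scalar" where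
  "phi \<Gamma> \<epsilon> c p = 2 * (\<Sum>a\<in>UNIV. nabla_vec \<Gamma> (Y_up \<Gamma> \<epsilon>) c a a p)"

definition W_up :: "('a, 2) tensor3 \<Rightarrow> ('a, 2) tensor2 \<Rightarrow> ('a, 2) tensor1" where
  "W_up \<Gamma> \<epsilon> c a p = (\<Sum>b\<in>UNIV. Y_up \<Gamma> \<epsilon> c b p * nabla_vec \<Gamma> (Y_up \<Gamma> \<epsilon>) c b a p)
     - 2 * phi \<Gamma> \<epsilon> c p / 3 * Y_up \<Gamma> \<epsilon> c a p"

definition rho :: "('a, 2) tensor3 \<Rightarrow> ('a, 2) tensor2 \<Rightarrow> ('a, 2) scalar" where
  "rho \<Gamma> \<epsilon> c p = (\<Sum>a\<in>UNIV. Y_low \<Gamma> \<epsilon> c a p * W_up \<Gamma> \<epsilon> c a p)"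

definition ell :: "('a, 2) tensor3 \<Rightarrow> ('a, 2) tensor2 \<Rightarrow> ('a, 2) scalar" where
  "ell \<Gamma> \<epsilon> c p = 5 * (phi \<Gamma> \<epsilon> c p)\<^sup>2 / 12
     + 3 * (\<Sum>a\<in>UNIV. \<Sum>b\<in>UNIV. rho_tensor \<Gamma> c a b p * Y_up \<Gamma> \<epsilon> c a p * Y_up \<Gamma> \<epsilon> c b p)
     - along (Y_up \<Gamma> \<epsilon>) (phi \<Gamma> \<epsilon>) c p / 2"

text \<open>Meaningful when \<open>rho\<close> vanishes and \<open>Y_low\<close> is nowhere zero: then there is exactly one
  such \<open>r\<close> at each point.\<close>

definition f_fun :: "('a, 2) tensor3 \<Rightarrow> ('a, 2) tensor2 \<Rightarrow> ('a, 2) scalar" where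
  "f_fun \<Gamma> \<epsilon> c p = (THE r. \<forall>a. W_up \<Gamma> \<epsilon> c a p = r * Y_up \<Gamma> \<epsilon> c a p)"

definition h_fun :: "('a, 2) tensor3 \<Rightarrow> ('a, 2) tensor2 \<Rightarrow> ('a, 2) scalar" where
  "h_fun \<Gamma> \<epsilon> c p = ell \<Gamma> \<epsilon> c p + f_fun \<Gamma> \<epsilon> c p * phi \<Gamma> \<epsilon> c p / 2"

definition k_fun :: "('a, 2) tensor3 \<Rightarrow> ('a, 2) tensor2 \<Rightarrow> ('a, 2) scalar" where
  "k_fun \<Gamma> \<epsilon> c p = 3 * phi \<Gamma> \<epsilon> c p * f_fun \<Gamma> \<epsilon> c p
     - 3 * along (Y_up \<Gamma> \<epsilon>) (f_fun \<Gamma> \<epsilon>) c p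
     + 12 * h_fun \<Gamma> \<epsilon> c p + 18 / 5 * (f_fun \<Gamma> \<epsilon> c p)\<^sup>2"

definition m_fun :: "('a, 2) tensor3 \<Rightarrow> ('a, 2) tensor2 \<Rightarrow> ('a, 2) scalar" where
  "m_fun \<Gamma> \<epsilon> c p = 6 * h_fun \<Gamma> \<epsilon> c p * f_fun \<Gamma> \<epsilon> c p / 5
     - along (Y_up \<Gamma> \<epsilon>) (h_fun \<Gamma> \<epsilon>) c p
     + 2 * phi \<Gamma> \<epsilon> c p * h_fun \<Gamma> \<epsilon> c p"

end

theory Submission
  imports Defs
begin

text \<open>
  The proof prolongs the pEW equation to a closed system and reads off its integrability
  conditions. Write \<open>t = \<mu>\<^sup>2\<close>, where \<open>\<mu>\<close> is the curvature of \<open>\<alpha>\<close>, that is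
  \<open>\<nabla>\<^sub>a \<alpha>\<^sub>b - \<nabla>\<^sub>b \<alpha>\<^sub>a = 2 \<mu> \<epsilon>\<^sub>a\<^sub>b\<close>, and let \<open>D = Y\<^sup>a \<nabla>\<^sub>a\<close>. The equation then says
  \<open>\<nabla>\<^sub>a \<alpha>\<^sub>b = - \<alpha>\<^sub>a \<alpha>\<^sub>b - P\<^sub>a\<^sub>b + \<mu> \<epsilon>\<^sub>a\<^sub>b\<close>. Commuting second derivatives of \<open>\<alpha>\<close> gives
  \<open>\<nabla>\<^sub>a \<mu> = - 3 \<mu> \<alpha>\<^sub>a - Y\<^sub>a / 2\<close> (\<open>pd_mu\<close>), so the system closes; commuting second derivatives
  of \<open>\<mu>\<close> gives the algebraic condition \<open>Y\<^sup>a \<alpha>\<^sub>a = - \<phi> / 6 - 4 t\<close> (\<open>Y_\<alpha>\<close>). Since \<open>Y\<^sup>a Y\<^sub>a = 0\<close>,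
  these two together yield the Riccati equation \<open>D t = \<phi> t + 24 t\<^sup>2\<close> (\<open>D_t\<close>).

  The vanishing of \<open>\<rho>\<close> makes the curves tangent to \<open>Y\<close> geodesics, so
  \<open>D (Y\<^sup>a \<alpha>\<^sub>a)\<close> is again a polynomial in \<open>Y\<^sup>a \<alpha>\<^sub>a\<close>, and therefore in \<open>t\<close>. Comparing with the
  derivative of the algebraic condition gives a quadratic equation for \<open>t\<close> whose coefficients
  depend only on \<open>\<nabla>\<close> and \<open>\<epsilon>\<close>, namely \<open>h = 240 t\<^sup>2 - 12 f t\<close> (\<open>h_eq\<close>). Its derivative along \<open>Y\<close>,
  reduced by the quadratic itself, is linear in \<open>t\<close>: \<open>m = - 4 t k\<close> (\<open>m_eq\<close>). Differentiating
  once more and using the linear relation to eliminate \<open>t\<close> leaves the asserted identity.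

  All of this takes place in one chart at a time. Two ingredients from calculus are needed: smooth
  functions are closed under the arithmetic operations and under partial derivatives, and partial
  derivatives commute.
\<close>

section \<open>Calculus of smooth functions on an open set\<close>

lemma partial_deriv_eq:
  assumes "(f has_derivative f') (at x)"
  shows "partial_deriv i f x = f' (axis i 1)"
  using frechet_derivative_at[OF assms] by (simp add: partial_deriv_def)

lemma partial_deriv_cong:
  assumes "open S" "x \<in> S" "\<And>y. y \<in> S \<Longrightarrow> f y = g y" "g differentiable (at x)"
  shows "partial_deriv i f x = partial_deriv i g x"
proof -
  have "(g has_derivative frechet_derivative g (at x)) (at x)"
    using assms(4) frechet_derivative_works by blast
  then have "(f has_derivative frechet_derivative g (at x)) (at x)"
    by (rule has_derivative_transform_within_open[OF _ assms(1,2)]) (simp add: assms(3))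
  from partial_deriv_eq[OF this] show ?thesis by (simp add: partial_deriv_def)
qed

lemma differentiable_cong_open:
  fixes f g :: "real^'n::finite \<Rightarrow> real"
  assumes "open S" "x \<in> S" "\<And>y. y \<in> S \<Longrightarrow> f y = g y" "g differentiable (at x)"
  shows "f differentiable (at x)"
  using assms(4) unfolding differentiable_def
  by (metis has_derivative_transform_within_open[OF _ assms(1,2)] assms(3))

lemma smooth_onD:
  assumes "smooth_on S f"
  shows "x \<in> S \<Longrightarrow> f differentiable (at x)" and "smooth_on S (partial_deriv i f)"
proof -
  show "f differentiable (at x)" if "x \<in> S"
    using assms that unfolding smooth_on_def by (metis foldr.simps(1) id_apply)
  show "smooth_on S (partial_deriv i f)"
    unfolding smooth_on_def
  proof (intro allI ballI)
    fix "is" x assume "x \<in> S"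
    then have "foldr partial_deriv (is @ [i]) f differentiable (at x)"
      using assms unfolding smooth_on_def by blast
    then show "foldr partial_deriv is (partial_deriv i f) differentiable (at x)" by simp
  qed
qed

text \<open>Smoothness is the largest predicate that implies differentiability and is inherited by the
  partial derivatives. This turns every closure property into a statement about first
  derivatives.\<close>

lemma smooth_on_coinduct:
  assumes "open S" "P f"
    and diff: "\<And>f x. P f \<Longrightarrow> x \<in> S \<Longrightarrow> f differentiable (at x)"
    and step: "\<And>f i. P f \<Longrightarrow> \<exists>g. P g \<and> (\<forall>x\<in>S. partial_deriv i f x = g x)"
  shows "smooth_on S f"
proof -
  have "P f \<Longrightarrow> \<exists>g. P g \<and> (\<forall>x\<in>S. foldr partial_deriv is f x = g x)" for "is" f
  proof (induction "is")
    case Nil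
    then show ?case by auto
  next
    case (Cons i "is")
    then obtain g where g: "P g" "\<And>x. x \<in> S \<Longrightarrow> foldr partial_deriv is f x = g x" by blast
    obtain g' where g': "P g'" "\<forall>x\<in>S. partial_deriv i g x = g' x" using step[OF g(1)] by blast
    have "foldr partial_deriv (i # is) f x = g' x" if "x \<in> S" for x
      using partial_deriv_cong[OF \<open>open S\<close> that g(2) diff[OF g(1) that]] g'(2) that by simp
    with g'(1) show ?case by blast
  qed
  then show ?thesis
    unfolding smooth_on_def using \<open>P f\<close> diff differentiable_cong_open[OF \<open>open S\<close>] by metis
qed

lemma smooth_on_cong:
  assumes "open S" "smooth_on S g" "\<And>x. x \<in> S \<Longrightarrow> f x = g x"
  shows "smooth_on S f"
proof (rule smooth_on_coinduct[where P = "\<lambda>f. \<exists>g. smooth_on S g \<and> (\<forall>x\<in>S. f x = g x)"])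
  show "\<exists>g. smooth_on S g \<and> (\<forall>x\<in>S. f x = g x)" using assms by blast
next
  fix f x assume "\<exists>g. smooth_on S g \<and> (\<forall>x\<in>S. f x = g x)" "x \<in> S"
  then show "f differentiable (at x)"
    using differentiable_cong_open[OF \<open>open S\<close>] smooth_onD(1) by metis
next
  fix f i assume "\<exists>g. smooth_on S g \<and> (\<forall>x\<in>S. f x = g x)"
  then obtain g where g: "smooth_on S g" "\<And>x. x \<in> S \<Longrightarrow> f x = g x" by blast
  have "\<forall>x\<in>S. partial_deriv i f x = partial_deriv i g x"
    by (metis partial_deriv_cong[OF \<open>open S\<close>] g(2) smooth_onD(1)[OF g(1)])
  then show "\<exists>g. (\<exists>g'. smooth_on S g' \<and> (\<forall>x\<in>S. g x = g' x)) \<and> (\<forall>x\<in>S. partial_deriv i f x = g x)"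
    using smooth_onD(2)[OF g(1)] by blast
qed (fact assms)

lemma smooth_on_const [simp]:
  fixes S :: "(real^'n::finite) set"
  shows "smooth_on S (\<lambda>_. r)"
proof -
  have "foldr partial_deriv is (\<lambda>_. r) \<in> range (\<lambda>r _. r)" for "is" :: "'n list"
  proof (induction "is")
    case (Cons i "is")
    then obtain s where "foldr partial_deriv is (\<lambda>_. r) = (\<lambda>_. s)" by auto
    moreover have "partial_deriv i (\<lambda>_. s) = (\<lambda>_. 0)"
      by (simp add: partial_deriv_def fun_eq_iff)
    ultimately show ?case by auto
  qed auto
  then show ?thesis unfolding smooth_on_def by (metis differentiable_const imageE)
qed

lemma partial_deriv_add:
  assumes "f differentiable (at x)" "g differentiable (at x)"
  shows "partial_deriv i (\<lambda>x. f x + g x) x = partial_deriv i f x + partial_deriv i g x"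
  using has_derivative_add[OF assms[unfolded frechet_derivative_works], THEN partial_deriv_eq]
  by (simp add: partial_deriv_def)

lemma partial_deriv_mult:
  assumes "f differentiable (at x)" "g differentiable (at x)"
  shows "partial_deriv i (\<lambda>x. f x * g x) x = f x * partial_deriv i g x + partial_deriv i f x * g x"
  using has_derivative_mult[OF assms[unfolded frechet_derivative_works], THEN partial_deriv_eq]
  by (simp add: partial_deriv_def)

lemma partial_deriv_inverse:
  assumes "f differentiable (at x)" "f x \<noteq> 0"
  shows "partial_deriv i (\<lambda>x. inverse (f x)) x
    = - 1 * (partial_deriv i f x * (inverse (f x) * inverse (f x)))"
  using Deriv.has_derivative_inverse[OF assms(2) assms(1)[unfolded frechet_derivative_works], THEN partial_deriv_eq]
  by (simp add: partial_deriv_def)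

text \<open>The derivative of a product or of an inverse is a polynomial in the functions themselves and
  their derivatives, so no single operation can be treated alone. The functions generated from the
  smooth ones by all the operations are closed under differentiation, and coinduction applies to
  them. Negatives arise as products with the constant \<open>-1\<close>.\<close>

inductive generated_smooth :: "(real^'n) set \<Rightarrow> (real^'n::finite \<Rightarrow> real) \<Rightarrow> bool"
  for S where
  base: "smooth_on S f \<Longrightarrow> generated_smooth S f"
| add: "generated_smooth S f \<Longrightarrow> generated_smooth S g \<Longrightarrow> generated_smooth S (\<lambda>x. f x + g x)"
| mult: "generated_smooth S f \<Longrightarrow> generated_smooth S g \<Longrightarrow> generated_smooth S (\<lambda>x. f x * g x)"
| inverse: "generated_smooth S f \<Longrightarrow> (\<And>x. x \<in> S \<Longrightarrow> f x \<noteq> 0) \<Longrightarrow>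
    generated_smooth S (\<lambda>x. inverse (f x))"

lemma generated_smooth_imp_smooth_on:
  assumes "open S" "generated_smooth S f"
  shows "smooth_on S f"
proof (rule smooth_on_coinduct[where P = "generated_smooth S", OF assms])
  show diff: "f differentiable (at x)" if "generated_smooth S f" "x \<in> S" for f x
    using that by (induction) (auto simp: smooth_onD(1) intro!: derivative_intros)
  show "\<exists>g. generated_smooth S g \<and> (\<forall>x\<in>S. partial_deriv i f x = g x)"
    if "generated_smooth S f" for f i
    using that
  proof induction
    case (base f)
    then show ?case using smooth_onD(2) generated_smooth.base by blast
  next
    case (add f g)
    then obtain f' g' where
      "generated_smooth S f'" "\<forall>x\<in>S. partial_deriv i f x = f' x"
      "generated_smooth S g'" "\<forall>x\<in>S. partial_deriv i g x = g' x" by blast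
    then show ?case
      using add(1,2)
      by (intro exI[of _ "\<lambda>x. f' x + g' x"]) (simp add: generated_smooth.add diff partial_deriv_add)
  next
    case (mult f g)
    then obtain f' g' where
      "generated_smooth S f'" "\<forall>x\<in>S. partial_deriv i f x = f' x"
      "generated_smooth S g'" "\<forall>x\<in>S. partial_deriv i g x = g' x" by blast
    then show ?case
      using mult(1,2)
      by (intro exI[of _ "\<lambda>x. f x * g' x + f' x * g x"])
        (simp add: generated_smooth.add generated_smooth.mult diff partial_deriv_mult)
  next
    case (inverse f)
    then obtain f' where f': "generated_smooth S f'" "\<forall>x\<in>S. partial_deriv i f x = f' x" by blast
    have "generated_smooth S (\<lambda>x. - 1 * (f' x * (inverse (f x) * inverse (f x))))"
      using f'(1) inverse(1,2)
      by (intro generated_smooth.mult generated_smooth.inverse) (auto intro: generated_smooth.base)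
    then show ?case
      using f'(2) inverse(1,2) diff
      by (intro exI[of _ "\<lambda>x. - 1 * (f' x * (inverse (f x) * inverse (f x)))"])
        (simp add: partial_deriv_inverse del: minus_mult_minus mult_minus1)
  qed
qed

lemma
  assumes "open S" "smooth_on S f" "smooth_on S g"
  shows smooth_on_add: "smooth_on S (\<lambda>x. f x + g x)"
    and smooth_on_mult: "smooth_on S (\<lambda>x. f x * g x)"
  using assms by (auto intro: generated_smooth_imp_smooth_on generated_smooth.intros)

lemma smooth_on_inverse:
  assumes "open S" "smooth_on S f" "\<And>x. x \<in> S \<Longrightarrow> f x \<noteq> 0"
  shows "smooth_on S (\<lambda>x. inverse (f x))"
  using assms by (auto intro: generated_smooth_imp_smooth_on generated_smooth.intros)

lemma partial_deriv_along_line: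
  assumes "f differentiable (at (x + t *\<^sub>R axis i 1))"
  shows "((\<lambda>t. f (x + t *\<^sub>R axis i 1)) has_real_derivative partial_deriv i f (x + t *\<^sub>R axis i 1)) (at t)"
proof -
  let ?D = "frechet_derivative f (at (x + t *\<^sub>R axis i 1))"
  have f: "(f has_derivative ?D) (at (x + t *\<^sub>R axis i 1))"
    using assms frechet_derivative_works by blast
  have "((\<lambda>t. x + t *\<^sub>R axis i 1) has_derivative (\<lambda>u. u *\<^sub>R axis i 1)) (at t)"
    by (auto intro!: derivative_eq_intros)
  from has_derivative_compose[OF this f]
  have "((\<lambda>t. f (x + t *\<^sub>R axis i 1)) has_derivative (\<lambda>u. ?D (u *\<^sub>R axis i 1))) (at t)" .
  moreover have "?D (u *\<^sub>R axis i 1) = u * partial_deriv i f (x + t *\<^sub>R axis i 1)" for u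
    using linear_cmul[OF has_derivative_linear[OF f]] by (simp add: partial_deriv_def)
  moreover have "(\<lambda>u. u * partial_deriv i f (x + t *\<^sub>R axis i 1)) = (*) (partial_deriv i f (x + t *\<^sub>R axis i 1))"
    by (simp add: fun_eq_iff mult.commute)
  ultimately show ?thesis by (simp add: has_field_derivative_def)
qed

text \<open>Two applications of the mean value theorem: in the direction \<open>i\<close> to the increment of \<open>f\<close>
  over \<open>s e\<^sub>j\<close>, then in the direction \<open>j\<close> to the partial derivative that results.\<close>

lemma second_difference_eq_partial_deriv:
  fixes x :: "real^'n::finite"
  assumes sm: "smooth_on S f" and "0 < s"
    and "\<forall>a\<in>{0..s}. \<forall>b\<in>{0..s}. x + a *\<^sub>R axis i 1 + b *\<^sub>R axis j 1 \<in> S"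
  shows "\<exists>a\<in>{0..s}. \<exists>b\<in>{0..s}.
    f (x + s *\<^sub>R axis i 1 + s *\<^sub>R axis j 1) - f (x + s *\<^sub>R axis i 1) - f (x + s *\<^sub>R axis j 1) + f x
      = s\<^sup>2 * partial_deriv j (partial_deriv i f) (x + a *\<^sub>R axis i 1 + b *\<^sub>R axis j 1)"
proof -
  let ?p = "\<lambda>a b. x + a *\<^sub>R axis i 1 + b *\<^sub>R axis j 1"
  have S: "?p a b \<in> S" if "0 \<le> a" "a \<le> s" "0 \<le> b" "b \<le> s" for a b
    using assms(3) that by simp
  have p: "(x + b *\<^sub>R axis j 1) + a *\<^sub>R axis i 1 = ?p a b" for a b
    by (simp add: algebra_simps)
  have di: "((\<lambda>t. f (?p t b)) has_real_derivative partial_deriv i f (?p a b)) (at a)"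
    if "0 \<le> a" "a \<le> s" "0 \<le> b" "b \<le> s" for a b
    using partial_deriv_along_line[of f "x + b *\<^sub>R axis j 1" a i] smooth_onD(1)[OF sm S[OF that]]
    by (simp add: p)
  have "\<exists>a>0. a < s \<and> (f (?p s s) - f (?p s 0)) - (f (?p 0 s) - f (?p 0 0))
      = (s - 0) * (partial_deriv i f (?p a s) - partial_deriv i f (?p a 0))"
    using \<open>0 < s\<close> by (intro MVT2 DERIV_diff di) auto
  then obtain a where a: "0 < a" "a < s" and
    1: "(f (?p s s) - f (?p s 0)) - (f (?p 0 s) - f (?p 0 0))
      = s * (partial_deriv i f (?p a s) - partial_deriv i f (?p a 0))" by auto
  have "\<exists>b>0. b < s \<and> partial_deriv i f (?p a s) - partial_deriv i f (?p a 0)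
      = (s - 0) * partial_deriv j (partial_deriv i f) (?p a b)"
    using \<open>0 < s\<close> a smooth_onD(1)[OF smooth_onD(2)[OF sm] S]
    by (intro MVT2 partial_deriv_along_line) auto
  then obtain b where "0 < b" "b < s" and
    "partial_deriv i f (?p a s) - partial_deriv i f (?p a 0)
      = s * partial_deriv j (partial_deriv i f) (?p a b)" by auto
  with a 1 show ?thesis
    by (intro bexI[where x = a] rev_bexI[where x = b]) (simp_all add: power2_eq_square mult.assoc)
qed

text \<open>The second difference is symmetric in the two directions, so the two mixed derivatives take
  a common value at points arbitrarily close to \<open>x\<close>; both are continuous.\<close>

theorem partial_deriv_commute:
  fixes x :: "real^'n::finite"
  assumes "open S" "smooth_on S f" "x \<in> S"
  shows "partial_deriv i (partial_deriv j f) x = partial_deriv j (partial_deriv i f) x"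
proof (rule ccontr)
  let ?D = "\<lambda>i j. partial_deriv j (partial_deriv i f)"
  assume "partial_deriv i (partial_deriv j f) x \<noteq> ?D i j x"
  then have e: "\<bar>?D i j x - ?D j i x\<bar> / 2 > 0" (is "?e > 0") by simp
  have cont: "\<exists>d>0. \<forall>y. dist y x < d \<longrightarrow> dist (?D i j y) (?D i j x) < ?e" for i j
  proof -
    have "?D i j differentiable (at x)"
      by (rule smooth_onD(1)[OF smooth_onD(2)[OF smooth_onD(2)[OF assms(2)]] assms(3)])
    then have "isCont (?D i j) x"
      by (rule differentiable_imp_continuous_within)
    then show ?thesis
      using e unfolding continuous_at_eps_delta by (elim allE[of _ ?e]) (simp only: simp_thms)
  qed
  obtain d1 where d1: "d1 > 0" "\<And>y. dist y x < d1 \<Longrightarrow> dist (?D i j y) (?D i j x) < ?e"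
    using cont[where i = i and j = j] by (elim exE conjE) simp
  obtain d2 where d2: "d2 > 0" "\<And>y. dist y x < d2 \<Longrightarrow> dist (?D j i y) (?D j i x) < ?e"
    using cont[where i = j and j = i] by (elim exE conjE) simp
  obtain d3 where d3: "d3 > 0" "\<And>y. dist y x < d3 \<Longrightarrow> y \<in> S"
    using assms(1,3) by (auto simp: open_dist)
  define s where "s = min d1 (min d2 d3) / 3"
  have s: "s > 0" "2 * s < d1" "2 * s < d2" "2 * s < d3"
    using d1(1) d2(1) d3(1) by (auto simp: s_def)
  have near: "dist (x + a *\<^sub>R axis k 1 + b *\<^sub>R axis l 1) x \<le> 2 * s"
    if "a \<in> {0..s}" "b \<in> {0..s}" for a b and k l :: 'n
  proof -
    have "norm (a *\<^sub>R axis k (1::real) + b *\<^sub>R axis l 1) \<le> \<bar>a\<bar> + \<bar>b\<bar>"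
      using norm_triangle_ineq[of "a *\<^sub>R axis k (1::real)" "b *\<^sub>R axis l 1"] by simp
    then show ?thesis using that by (simp add: dist_norm add.assoc)
  qed
  have in_S: "\<forall>a\<in>{0..s}. \<forall>b\<in>{0..s}. x + a *\<^sub>R axis k 1 + b *\<^sub>R axis l 1 \<in> S" for k l :: 'n
    using near s(4) by (intro ballI d3(2)) (rule le_less_trans)
  let ?\<Delta> = "\<lambda>i j. f (x + s *\<^sub>R axis i 1 + s *\<^sub>R axis j 1) - f (x + s *\<^sub>R axis i 1)
    - f (x + s *\<^sub>R axis j 1) + f x"
  have ex: "\<exists>y. dist y x \<le> 2 * s \<and> ?\<Delta> i j = s\<^sup>2 * ?D i j y" for i j
  proof -
    obtain a b where ab: "a \<in> {0..s}" "b \<in> {0..s}" and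
      "?\<Delta> i j = s\<^sup>2 * ?D i j (x + a *\<^sub>R axis i 1 + b *\<^sub>R axis j 1)"
      using second_difference_eq_partial_deriv[OF assms(2) s(1) in_S[where k = i and l = j]]
      by (elim bexE)
    with near[OF ab, where k = i and l = j] show ?thesis by (intro exI conjI)
  qed
  obtain y z where y: "dist y x \<le> 2 * s" "?\<Delta> i j = s\<^sup>2 * ?D i j y"
    and z: "dist z x \<le> 2 * s" "?\<Delta> j i = s\<^sup>2 * ?D j i z"
    using ex[where i = i and j = j] ex[where i = j and j = i] by (elim exE conjE)
  have "?\<Delta> i j = ?\<Delta> j i" by (simp add: algebra_simps)
  then have "?D i j y = ?D j i z" using y(2) z(2) s(1) by simp
  moreover have "dist (?D i j y) (?D i j x) < ?e" "dist (?D j i z) (?D j i x) < ?e"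
    using y(1) z(1) s by (simp_all only: d1(2) d2(2) le_less_trans[OF y(1)] le_less_trans[OF z(1)])
  ultimately show False unfolding dist_real_def by argo
qed

section \<open>Calculus in a chart\<close>

locale chart_calculus =
  fixes c :: "('a, 'n::finite) chart"
  assumes open_coord: "open (coord c ` domain c)"
    and inj_coord: "inj_on (coord c) (domain c)"
begin

lemma param_coord [simp]: "p \<in> domain c \<Longrightarrow> param c (coord c p) = p"
  by (simp add: param_def inj_coord)

lemma smooth_in_differentiable:
  "smooth_in c F \<Longrightarrow> p \<in> domain c \<Longrightarrow> (F \<circ> param c) differentiable (at (coord c p))"
  by (auto simp: smooth_in_def intro: smooth_onD(1))

lemma smooth_in_cong:
  assumes "smooth_in c G" "\<And>p. p \<in> domain c \<Longrightarrow> F p = G p"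
  shows "smooth_in c F"
  using assms(1) unfolding smooth_in_def
  by (rule smooth_on_cong[OF open_coord]) (auto simp: assms(2))

lemma pd_cong:
  assumes "smooth_in c G" "\<And>p. p \<in> domain c \<Longrightarrow> F p = G p" "p \<in> domain c"
  shows "pd c i F p = pd c i G p"
  unfolding pd_def
  by (rule partial_deriv_cong[OF open_coord _ _ smooth_in_differentiable[OF assms(1)]])
    (auto simp: assms)

lemma smooth_in_pd:
  assumes "smooth_in c F"
  shows "smooth_in c (pd c i F)"
  using smooth_onD(2)[OF assms[unfolded smooth_in_def], of i] unfolding smooth_in_def
  by (rule smooth_on_cong[OF open_coord]) (auto simp: pd_def)

lemma smooth_in_const: "smooth_in c (\<lambda>_. r)"
  by (simp add: smooth_in_def o_def)

lemma smooth_in_add: "smooth_in c F \<Longrightarrow> smooth_in c G \<Longrightarrow> smooth_in c (\<lambda>p. F p + G p)"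
  using smooth_on_add[OF open_coord] by (fastforce simp: smooth_in_def o_def)

lemma smooth_in_mult: "smooth_in c F \<Longrightarrow> smooth_in c G \<Longrightarrow> smooth_in c (\<lambda>p. F p * G p)"
  using smooth_on_mult[OF open_coord] by (fastforce simp: smooth_in_def o_def)

lemma smooth_in_uminus: "smooth_in c F \<Longrightarrow> smooth_in c (\<lambda>p. - F p)"
  using smooth_in_mult[OF smooth_in_const[of "-1"], of F] by simp

lemma smooth_in_diff: "smooth_in c F \<Longrightarrow> smooth_in c G \<Longrightarrow> smooth_in c (\<lambda>p. F p - G p)"
  using smooth_in_add[OF _ smooth_in_uminus, of F G] by simp

lemma smooth_in_power: "smooth_in c F \<Longrightarrow> smooth_in c (\<lambda>p. F p ^ n)"
  by (induction n) (auto intro: smooth_in_const smooth_in_mult)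

lemma smooth_in_divide:
  assumes "smooth_in c F" "smooth_in c G" "\<And>p. p \<in> domain c \<Longrightarrow> G p \<noteq> 0"
  shows "smooth_in c (\<lambda>p. F p / G p)"
proof -
  have "smooth_in c (\<lambda>p. inverse (G p))"
    using smooth_on_inverse[OF open_coord assms(2)[unfolded smooth_in_def]] assms(3)
    by (fastforce simp: smooth_in_def o_def)
  from smooth_in_mult[OF assms(1) this] show ?thesis by (simp add: divide_inverse)
qed

lemmas smooth_intros =
  smooth_in_pd smooth_in_const smooth_in_add smooth_in_mult smooth_in_uminus smooth_in_diff
  smooth_in_power smooth_in_divide

lemma pd_const [simp]: "pd c i (\<lambda>_. r) p = 0"
  by (simp add: pd_def o_def partial_deriv_def)

lemma pd_add:
  assumes "smooth_in c F" "smooth_in c G" "p \<in> domain c"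
  shows "pd c i (\<lambda>p. F p + G p) p = pd c i F p + pd c i G p"
  using partial_deriv_add[OF assms(1,2)[THEN smooth_in_differentiable[OF _ assms(3)]], of i]
  by (simp add: pd_def o_def)

lemma pd_mult:
  assumes "smooth_in c F" "smooth_in c G" "p \<in> domain c"
  shows "pd c i (\<lambda>p. F p * G p) p = F p * pd c i G p + pd c i F p * G p"
  using partial_deriv_mult[OF assms(1,2)[THEN smooth_in_differentiable[OF _ assms(3)]], of i] assms(3)
  by (simp add: pd_def o_def)

lemma pd_uminus:
  assumes "smooth_in c F" "p \<in> domain c"
  shows "pd c i (\<lambda>p. - F p) p = - pd c i F p"
  using pd_mult[OF smooth_in_const[of "-1"] assms, of i] by simp

lemma pd_diff:
  assumes "smooth_in c F" "smooth_in c G" "p \<in> domain c"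
  shows "pd c i (\<lambda>p. F p - G p) p = pd c i F p - pd c i G p"
  using pd_add[OF assms(1) smooth_in_uminus[OF assms(2)] assms(3), of i] pd_uminus[OF assms(2,3)]
  by simp

lemma pd_commute:
  assumes "smooth_in c F" "p \<in> domain c"
  shows "pd c i (pd c j F) p = pd c j (pd c i F) p"
proof -
  let ?F = "F \<circ> param c" and ?S = "coord c ` domain c"
  have "pd c i (pd c j F) p = partial_deriv i (partial_deriv j ?F) (coord c p)" for i j
    unfolding pd_def[of _ i] using assms
    by (intro partial_deriv_cong[OF open_coord])
      (auto simp: pd_def smooth_in_def intro!: smooth_onD)
  then show ?thesis
    using partial_deriv_commute[OF open_coord assms(1)[unfolded smooth_in_def]] assms(2) by simp
qed

end

section \<open>The special connection in a chart\<close>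

locale special_chart = chart_calculus c
  for c :: "('a, 2) chart" +
  fixes \<Gamma> :: "('a, 2) tensor3" and \<epsilon> :: "('a, 2) tensor2"
  assumes smooth_\<Gamma>: "smooth_in c (\<Gamma> c k a b)"
    and sym_\<Gamma>: "p \<in> domain c \<Longrightarrow> \<Gamma> c k a b p = \<Gamma> c k b a p"
    and smooth_\<epsilon>: "smooth_in c (\<epsilon> c a b)"
    and skew_\<epsilon>: "p \<in> domain c \<Longrightarrow> \<epsilon> c a b p = - \<epsilon> c b a p"
    and nonzero_\<epsilon>: "p \<in> domain c \<Longrightarrow> \<epsilon> c 1 2 p \<noteq> 0"
    and parallel_\<epsilon>: "p \<in> domain c \<Longrightarrow> nabla_cov2 \<Gamma> \<epsilon> c a b d p = 0"
begin

lemma \<epsilon>_components: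
  assumes "p \<in> domain c"
  shows "\<epsilon> c 1 1 p = 0" "\<epsilon> c 2 2 p = 0" "\<epsilon> c 2 1 p = - \<epsilon> c 1 2 p"
  using skew_\<epsilon>[OF assms, of 1 1] skew_\<epsilon>[OF assms, of 2 2] skew_\<epsilon>[OF assms, of 2 1] by auto

lemma eps_up_components:
  assumes "p \<in> domain c"
  shows "eps_up \<epsilon> c 1 1 p = 0" "eps_up \<epsilon> c 2 2 p = 0"
    "eps_up \<epsilon> c 1 2 p = 1 / \<epsilon> c 1 2 p" "eps_up \<epsilon> c 2 1 p = - (1 / \<epsilon> c 1 2 p)"
proof -
  let ?A = "transpose (\<chi> i j. \<epsilon> c i j p) :: real^2^2"
  let ?B = "vector [vector [0, 1 / \<epsilon> c 1 2 p], vector [- (1 / \<epsilon> c 1 2 p), 0]] :: real^2^2"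
  have AB: "?A ** ?B = mat 1" and BA: "?B ** ?A = mat 1"
    using \<epsilon>_components[OF assms] nonzero_\<epsilon>[OF assms]
    by (simp_all add: vec_eq_iff forall_2 matrix_matrix_mult_def sum_2 transpose_def mat_def)
  have "?A ** matrix_inv ?A = mat 1"
    unfolding matrix_inv_def by (rule someI2[where a = ?B]) (intro conjI AB BA, rule conjunct1)
  then have "(?B ** ?A) ** matrix_inv ?A = ?B"
    by (simp only: matrix_mul_assoc[symmetric] matrix_mul_rid)
  then have "matrix_inv ?A = ?B"
    by (simp only: BA matrix_mul_lid)
  then show "eps_up \<epsilon> c 1 1 p = 0" "eps_up \<epsilon> c 2 2 p = 0"
    "eps_up \<epsilon> c 1 2 p = 1 / \<epsilon> c 1 2 p" "eps_up \<epsilon> c 2 1 p = - (1 / \<epsilon> c 1 2 p)"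
    by (simp_all add: eps_up_def)
qed

lemma pd_\<epsilon>: "p \<in> domain c \<Longrightarrow> pd c a (\<epsilon> c 1 2) p = (\<Gamma> c 1 a 1 p + \<Gamma> c 2 a 2 p) * \<epsilon> c 1 2 p"
  using parallel_\<epsilon>[of p a 1 2] skew_\<epsilon>[of p 1 1] skew_\<epsilon>[of p 2 2]
  by (simp add: nabla_cov2_def sum_2 algebra_simps)

lemma curvature_eq:
  assumes "p \<in> domain c"
  shows "curvature \<Gamma> c a b k d p = pd c a (\<Gamma> c k b d) p - pd c b (\<Gamma> c k a d) p
    + (\<Gamma> c k a 1 p * \<Gamma> c 1 b d p + \<Gamma> c k a 2 p * \<Gamma> c 2 b d p)
    - (\<Gamma> c k b 1 p * \<Gamma> c 1 a d p + \<Gamma> c k b 2 p * \<Gamma> c 2 a d p)"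
proof -
  have "nabla_vec \<Gamma> (coord_vec d) c b k = \<Gamma> c k b d" for b k
  proof
    fix q
    have const: "coord_vec d c k = (\<lambda>_. if k = d then 1 else 0)"
      by (simp add: fun_eq_iff coord_vec_def)
    show "nabla_vec \<Gamma> (coord_vec d) c b k q = \<Gamma> c k b d q"
      using exhaust_2[of d] by (auto simp: nabla_vec_def const sum_2 coord_vec_def)
  qed
  then show ?thesis
    using sym_\<Gamma>[OF assms, of _ a b] by (simp add: curvature_def nabla_mixed_def sum_2)
qed

lemma smooth_curvature: "smooth_in c (curvature \<Gamma> c a b k d)"
  by (rule smooth_in_cong[OF _ curvature_eq]) (intro smooth_intros smooth_\<Gamma>)+

lemma smooth_rho_tensor: "smooth_in c (rho_tensor \<Gamma> c a b)"
proof -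
  have "rho_tensor \<Gamma> c a b = (\<lambda>p. 2 / 3 * (curvature \<Gamma> c 1 a 1 b p + curvature \<Gamma> c 2 a 2 b p)
      + 1 / 3 * (curvature \<Gamma> c 1 b 1 a p + curvature \<Gamma> c 2 b 2 a p))"
    by (auto simp: fun_eq_iff rho_tensor_def ricci_def sum_2)
  then show ?thesis by (simp only:) (intro smooth_intros smooth_curvature)
qed

text \<open>The trace of the curvature on the last two indices is the curvature of the connection that
  \<open>\<nabla>\<close> induces on area forms, which is flat because \<open>\<epsilon>\<close> is parallel.\<close>

lemma trace_curvature:
  assumes p: "p \<in> domain c"
  shows "curvature \<Gamma> c 1 2 1 1 p + curvature \<Gamma> c 1 2 2 2 p = 0"
proof -
  have *: "pd c b (pd c a (\<epsilon> c 1 2)) p =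
      (pd c b (\<Gamma> c 1 a 1) p + pd c b (\<Gamma> c 2 a 2) p
        + (\<Gamma> c 1 a 1 p + \<Gamma> c 2 a 2 p) * (\<Gamma> c 1 b 1 p + \<Gamma> c 2 b 2 p)) * \<epsilon> c 1 2 p" for a b
  proof -
    have "pd c b (pd c a (\<epsilon> c 1 2)) p = pd c b (\<lambda>p. (\<Gamma> c 1 a 1 p + \<Gamma> c 2 a 2 p) * \<epsilon> c 1 2 p) p"
      by (rule pd_cong[OF _ pd_\<epsilon> p]) (intro smooth_intros smooth_\<Gamma> smooth_\<epsilon>)+
    also have "\<dots> = (\<Gamma> c 1 a 1 p + \<Gamma> c 2 a 2 p) * pd c b (\<epsilon> c 1 2) p
        + (pd c b (\<Gamma> c 1 a 1) p + pd c b (\<Gamma> c 2 a 2) p) * \<epsilon> c 1 2 p"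
      by (simp add: pd_mult pd_add smooth_\<Gamma> smooth_\<epsilon> smooth_intros p)
    finally show ?thesis by (simp add: pd_\<epsilon>[OF p] algebra_simps)
  qed
  have "(pd c 1 (\<Gamma> c 1 2 1) p + pd c 1 (\<Gamma> c 2 2 2) p) * \<epsilon> c 1 2 p
      = (pd c 2 (\<Gamma> c 1 1 1) p + pd c 2 (\<Gamma> c 2 1 2) p) * \<epsilon> c 1 2 p"
    using pd_commute[OF smooth_\<epsilon> p, of 1 2 1 2] unfolding * by (simp add: algebra_simps)
  then show ?thesis
    using nonzero_\<epsilon>[OF p] by (simp add: curvature_eq[OF p])
qed

text \<open>In dimension two the Ricci tensor determines the curvature. For a connection that preserves an
  area form this reads \<open>R\<^sub>a\<^sub>b\<^sup>k\<^sub>d = \<delta>\<^sub>a\<^sup>k P\<^sub>b\<^sub>d - \<delta>\<^sub>b\<^sup>k P\<^sub>a\<^sub>d\<close> with symmetric \<open>P\<close>.\<close>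

lemma rho_tensor_curvature:
  assumes p: "p \<in> domain c"
  shows "rho_tensor \<Gamma> c 1 2 p = rho_tensor \<Gamma> c 2 1 p"
    and "curvature \<Gamma> c 1 2 1 1 p = rho_tensor \<Gamma> c 1 2 p"
    and "curvature \<Gamma> c 1 2 1 2 p = rho_tensor \<Gamma> c 2 2 p"
    and "curvature \<Gamma> c 1 2 2 1 p = - rho_tensor \<Gamma> c 1 1 p"
    and "curvature \<Gamma> c 1 2 2 2 p = - rho_tensor \<Gamma> c 1 2 p"
proof -
  have skew: "curvature \<Gamma> c a a k d p = 0" "curvature \<Gamma> c 2 1 k d p = - curvature \<Gamma> c 1 2 k d p" for a k d
    by (simp_all add: curvature_def)
  show "rho_tensor \<Gamma> c 1 2 p = rho_tensor \<Gamma> c 2 1 p"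
    and "curvature \<Gamma> c 1 2 1 1 p = rho_tensor \<Gamma> c 1 2 p"
    and "curvature \<Gamma> c 1 2 1 2 p = rho_tensor \<Gamma> c 2 2 p"
    and "curvature \<Gamma> c 1 2 2 1 p = - rho_tensor \<Gamma> c 1 1 p"
    and "curvature \<Gamma> c 1 2 2 2 p = - rho_tensor \<Gamma> c 1 2 p"
    using trace_curvature[OF p]
    by (simp_all add: rho_tensor_def ricci_def sum_2 skew)
qed

lemma Y_low_eq:
  assumes p: "p \<in> domain c"
  shows "Y_low \<Gamma> \<epsilon> c a p = 2 / \<epsilon> c 1 2 p * cotton_york \<Gamma> c 1 2 a p"
proof -
  have "cotton_york \<Gamma> c 2 1 a p = - cotton_york \<Gamma> c 1 2 a p"
    by (simp add: cotton_york_def)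
  then show ?thesis by (simp add: Y_low_def sum_2 eps_up_components[OF p])
qed

lemma smooth_Y_low: "smooth_in c (Y_low \<Gamma> \<epsilon> c a)"
  by (rule smooth_in_cong[OF _ Y_low_eq], unfold cotton_york_def nabla_cov2_def sum_2)
    (intro smooth_intros smooth_\<Gamma> smooth_\<epsilon> smooth_rho_tensor nonzero_\<epsilon>)+

lemma Y_up_eq:
  assumes p: "p \<in> domain c"
  shows "Y_up \<Gamma> \<epsilon> c 1 p = Y_low \<Gamma> \<epsilon> c 2 p / \<epsilon> c 1 2 p"
    and "Y_up \<Gamma> \<epsilon> c 2 p = - (Y_low \<Gamma> \<epsilon> c 1 p / \<epsilon> c 1 2 p)"
  by (simp_all add: Y_up_def raise_def sum_2 eps_up_components[OF p])

lemma smooth_Y_up: "smooth_in c (Y_up \<Gamma> \<epsilon> c a)"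
proof -
  have "smooth_in c (Y_up \<Gamma> \<epsilon> c 1)"
    by (rule smooth_in_cong[OF smooth_in_divide[OF smooth_Y_low smooth_\<epsilon> nonzero_\<epsilon>] Y_up_eq(1)])
  moreover have "smooth_in c (Y_up \<Gamma> \<epsilon> c 2)"
    by (rule smooth_in_cong[OF smooth_in_uminus[OF smooth_in_divide[OF smooth_Y_low smooth_\<epsilon> nonzero_\<epsilon>]] Y_up_eq(2)])
  ultimately show ?thesis using exhaust_2[of a] by auto
qed

text \<open>Because \<open>\<epsilon>\<close> is parallel, the divergence of \<open>Y\<^sup>a\<close> times \<open>\<epsilon>\<close> is the exterior derivative of
  \<open>Y\<^sub>a\<close>; in this form \<open>\<phi>\<close> appears as an integrability condition.\<close>

lemma phi_eq:
  assumes p: "p \<in> domain c"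
  shows "phi \<Gamma> \<epsilon> c p * \<epsilon> c 1 2 p = 2 * (pd c 1 (Y_low \<Gamma> \<epsilon> c 2) p - pd c 2 (Y_low \<Gamma> \<epsilon> c 1) p)"
proof -
  let ?E = "\<epsilon> c 1 2" and ?U = "Y_up \<Gamma> \<epsilon> c"
  have "pd c 1 (Y_low \<Gamma> \<epsilon> c 2) p = pd c 1 (\<lambda>p. ?U 1 p * ?E p) p"
    by (rule pd_cong[OF _ _ p]) (simp_all add: smooth_intros smooth_Y_up smooth_\<epsilon> Y_up_eq nonzero_\<epsilon>)
  also have "\<dots> = ?U 1 p * pd c 1 ?E p + pd c 1 (?U 1) p * ?E p"
    by (simp add: pd_mult smooth_Y_up smooth_\<epsilon> p)
  finally have 1: "pd c 1 (Y_low \<Gamma> \<epsilon> c 2) p = \<dots>" .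
  have "pd c 2 (Y_low \<Gamma> \<epsilon> c 1) p = pd c 2 (\<lambda>p. - (?U 2 p * ?E p)) p"
    by (rule pd_cong[OF _ _ p]) (simp_all add: smooth_intros smooth_Y_up smooth_\<epsilon> Y_up_eq nonzero_\<epsilon>)
  also have "\<dots> = - (?U 2 p * pd c 2 ?E p + pd c 2 (?U 2) p * ?E p)"
    by (simp add: pd_mult pd_uminus smooth_in_mult smooth_Y_up smooth_\<epsilon> p)
  finally have 2: "pd c 2 (Y_low \<Gamma> \<epsilon> c 1) p = \<dots>" .
  show ?thesis
    unfolding 1 2 using sym_\<Gamma>[OF p, of 1 1 2] sym_\<Gamma>[OF p, of 2 1 2]
    by (simp add: phi_def nabla_vec_def sum_2 pd_\<epsilon>[OF p] algebra_simps)
qed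

lemma smooth_phi: "smooth_in c (phi \<Gamma> \<epsilon> c)"
  unfolding phi_def[abs_def] nabla_vec_def sum_2
  by (intro smooth_intros smooth_\<Gamma> smooth_Y_up)

lemma smooth_W_up: "smooth_in c (W_up \<Gamma> \<epsilon> c a)"
  unfolding W_up_def[abs_def] nabla_vec_def sum_2
  by (intro smooth_intros smooth_\<Gamma> smooth_Y_up smooth_phi) simp

lemma smooth_along: "smooth_in c (F c) \<Longrightarrow> smooth_in c (along (Y_up \<Gamma> \<epsilon>) F c)"
  unfolding along_def[abs_def] sum_2 by (intro smooth_intros smooth_Y_up)

end

section \<open>Prolongation of the pEW equation\<close>

locale pEW_chart = special_chart c \<Gamma> \<epsilon>
  for c :: "('a, 2) chart" and \<Gamma> :: "('a, 2) tensor3" and \<epsilon> :: "('a, 2) tensor2" +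
  fixes \<alpha> :: "('a, 2) tensor1"
  assumes smooth_\<alpha>: "smooth_in c (\<alpha> c a)"
    and pEW_eq: "p \<in> domain c \<Longrightarrow> (nabla_form \<Gamma> \<alpha> c a b p + nabla_form \<Gamma> \<alpha> c b a p) / 2
      + \<alpha> c a p * \<alpha> c b p + (rho_tensor \<Gamma> c a b p + rho_tensor \<Gamma> c b a p) / 2 = 0"
begin

text \<open>The part of the first jet of \<open>\<alpha>\<close> that the pEW equation leaves free: the exterior derivative of
  \<open>\<alpha>\<close> is \<open>2 \<mu> \<epsilon>\<close>.\<close>

definition mu :: "'a \<Rightarrow> real" where
  "mu p = (pd c 1 (\<alpha> c 2) p - pd c 2 (\<alpha> c 1) p) / (2 * \<epsilon> c 1 2 p)"

lemma smooth_mu: "smooth_in c mu"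
  unfolding mu_def[abs_def] using nonzero_\<epsilon> by (intro smooth_intros smooth_\<alpha> smooth_\<epsilon>) simp

lemma pd_\<alpha>:
  assumes p: "p \<in> domain c"
  shows "pd c a (\<alpha> c b) p = \<Gamma> c 1 a b p * \<alpha> c 1 p + \<Gamma> c 2 a b p * \<alpha> c 2 p
    - \<alpha> c a p * \<alpha> c b p - rho_tensor \<Gamma> c a b p + mu p * \<epsilon> c a b p"
proof -
  note e = \<epsilon>_components[OF p]
  have m: "mu p * \<epsilon> c 1 2 p = (pd c 1 (\<alpha> c 2) p - pd c 2 (\<alpha> c 1) p) / 2"
    using nonzero_\<epsilon>[OF p] by (simp add: mu_def)
  show ?thesis
    using pEW_eq[OF p, of a b] exhaust_2[of a] exhaust_2[of b] rho_tensor_curvature(1)[OF p]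
      sym_\<Gamma>[OF p, of 1 1 2] sym_\<Gamma>[OF p, of 2 1 2]
    by (auto simp: nabla_form_def sum_2 e m algebra_simps field_simps)
qed

lemma pd_pd_\<alpha>:
  assumes p: "p \<in> domain c"
  shows "pd c d (pd c a (\<alpha> c b)) p =
      pd c d (\<Gamma> c 1 a b) p * \<alpha> c 1 p + \<Gamma> c 1 a b p * pd c d (\<alpha> c 1) p
    + (pd c d (\<Gamma> c 2 a b) p * \<alpha> c 2 p + \<Gamma> c 2 a b p * pd c d (\<alpha> c 2) p)
    - (pd c d (\<alpha> c a) p * \<alpha> c b p + \<alpha> c a p * pd c d (\<alpha> c b) p)
    - pd c d (rho_tensor \<Gamma> c a b) p
    + (pd c d mu p * \<epsilon> c a b p + mu p * pd c d (\<epsilon> c a b) p)"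
proof -
  have "pd c d (pd c a (\<alpha> c b)) p = pd c d (\<lambda>p. \<Gamma> c 1 a b p * \<alpha> c 1 p + \<Gamma> c 2 a b p * \<alpha> c 2 p
      - \<alpha> c a p * \<alpha> c b p - rho_tensor \<Gamma> c a b p + mu p * \<epsilon> c a b p) p"
    by (rule pd_cong[OF _ pd_\<alpha> p])
      (intro smooth_intros smooth_\<Gamma> smooth_\<alpha> smooth_rho_tensor smooth_mu smooth_\<epsilon>)+
  also have "\<dots> = pd c d (\<Gamma> c 1 a b) p * \<alpha> c 1 p + \<Gamma> c 1 a b p * pd c d (\<alpha> c 1) p
    + (pd c d (\<Gamma> c 2 a b) p * \<alpha> c 2 p + \<Gamma> c 2 a b p * pd c d (\<alpha> c 2) p)
    - (pd c d (\<alpha> c a) p * \<alpha> c b p + \<alpha> c a p * pd c d (\<alpha> c b) p)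
    - pd c d (rho_tensor \<Gamma> c a b) p
    + (pd c d mu p * \<epsilon> c a b p + mu p * pd c d (\<epsilon> c a b) p)"
    by (simp add: pd_add pd_diff pd_mult smooth_intros smooth_\<Gamma> smooth_\<alpha> smooth_rho_tensor
        smooth_mu smooth_\<epsilon> p)
  finally show ?thesis .
qed

text \<open>The integrability condition of the formula for \<open>\<nabla>\<^sub>a \<alpha>\<^sub>b\<close>. The terms \<open>P\<^sub>a\<^sub>b \<alpha>\<^sub>c\<close> coming from the
  curvature cancel those coming from the derivative of \<open>\<alpha>\<^sub>a \<alpha>\<^sub>b\<close>, and the antisymmetrized
  derivative of \<open>P\<close> is the Cotton-York tensor.\<close>

lemma pd_mu:
  assumes p: "p \<in> domain c"
  shows "pd c a mu p = - 3 * mu p * \<alpha> c a p - Y_low \<Gamma> \<epsilon> c a p / 2"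
proof -
  note e = \<epsilon>_components
  have pd_e: "pd c a (\<epsilon> c 1 1) p = 0" "pd c a (\<epsilon> c 2 2) p = 0"
    "pd c a (\<epsilon> c 2 1) p = - pd c a (\<epsilon> c 1 2) p" for a
    using pd_cong[OF smooth_in_const[of 0] e(1) p, where i = a] pd_cong[OF smooth_in_const[of 0] e(2) p, where i = a]
      pd_cong[OF smooth_in_uminus[OF smooth_\<epsilon>] e(3) p, where i = a]
    by (simp_all add: pd_uminus smooth_\<epsilon> p)
  have s\<Gamma>: "\<Gamma> c k 2 1 p = \<Gamma> c k 1 2 p" "pd c a (\<Gamma> c k 2 1) p = pd c a (\<Gamma> c k 1 2) p" for a k
    using pd_cong[OF smooth_\<Gamma>[of k 1 2] sym_\<Gamma>[of _ k 2 1] p, where i = a] by (simp_all add: sym_\<Gamma>[OF p, of k 2 1])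
  have sP: "rho_tensor \<Gamma> c 2 1 p = rho_tensor \<Gamma> c 1 2 p"
    "pd c a (rho_tensor \<Gamma> c 2 1) p = pd c a (rho_tensor \<Gamma> c 1 2) p" for a
    using rho_tensor_curvature(1)[OF p] pd_cong[OF smooth_rho_tensor rho_tensor_curvature(1)[symmetric] p, where i = a]
    by simp_all
  note R = rho_tensor_curvature(2-5)[OF p, unfolded curvature_eq[OF p] s\<Gamma>]
  have Y: "\<epsilon> c 1 2 p * Y_low \<Gamma> \<epsilon> c a p = 2 * cotton_york \<Gamma> c 1 2 a p" for a
    using nonzero_\<epsilon>[OF p] by (simp add: Y_low_eq[OF p])
  \<comment> \<open>As \<open>\<epsilon>\<^sub>1\<^sub>1 = 0\<close>, of the two mixed second derivatives of \<open>\<alpha>\<^sub>1\<close> only \<open>\<partial>\<^sub>1 \<partial>\<^sub>2 \<alpha>\<^sub>1\<close> contains a derivative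
    of \<open>\<mu>\<close>, namely \<open>\<partial>\<^sub>1 \<mu>\<close>; likewise for \<open>\<alpha>\<^sub>2\<close> and \<open>\<partial>\<^sub>2 \<mu>\<close>.\<close>
  have "\<epsilon> c 1 2 p * pd c 1 mu p = \<epsilon> c 1 2 p * (- 3 * mu p * \<alpha> c 1 p - Y_low \<Gamma> \<epsilon> c 1 p / 2)"
    using pd_commute[OF smooth_\<alpha>[of 1] p, of 1 2] R Y[of 1]
    unfolding pd_pd_\<alpha>[OF p] pd_\<alpha>[OF p] e[OF p] pd_e pd_\<epsilon>[OF p] s\<Gamma> sP cotton_york_def nabla_cov2_def sum_2
    by algebra
  moreover have "\<epsilon> c 1 2 p * pd c 2 mu p = \<epsilon> c 1 2 p * (- 3 * mu p * \<alpha> c 2 p - Y_low \<Gamma> \<epsilon> c 2 p / 2)"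
    using pd_commute[OF smooth_\<alpha>[of 2] p, of 1 2] R Y[of 2]
    unfolding pd_pd_\<alpha>[OF p] pd_\<alpha>[OF p] e[OF p] pd_e pd_\<epsilon>[OF p] s\<Gamma> sP cotton_york_def nabla_cov2_def sum_2
    by algebra
  ultimately show ?thesis
    using nonzero_\<epsilon>[OF p] exhaust_2[of a] by (simp only: mult_cancel_left) auto
qed

text \<open>The exterior derivative of \<open>- 3 \<mu> \<alpha>\<^sub>a - Y\<^sub>a / 2\<close> vanishes. In it the derivative of \<open>\<mu>\<close>
  contributes \<open>Y\<^sup>a \<alpha>\<^sub>a\<close>, the exterior derivative of \<open>\<alpha>\<close> contributes \<open>\<mu>\<^sup>2\<close>, and that of \<open>Y\<^sub>a\<close>
  contributes \<open>\<phi>\<close>.\<close>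

lemma Y_\<alpha>:
  assumes p: "p \<in> domain c"
  shows "Y_up \<Gamma> \<epsilon> c 1 p * \<alpha> c 1 p + Y_up \<Gamma> \<epsilon> c 2 p * \<alpha> c 2 p = - phi \<Gamma> \<epsilon> c p / 6 - 4 * (mu p)\<^sup>2"
proof -
  let ?E = "\<epsilon> c 1 2 p" and ?Y = "Y_low \<Gamma> \<epsilon> c"
  have dd: "pd c b (pd c a mu) p = - 3 * (pd c b mu p * \<alpha> c a p + mu p * pd c b (\<alpha> c a) p) - pd c b (?Y a) p / 2"
    for a b
  proof -
    have "pd c b (pd c a mu) p = pd c b (\<lambda>p. - 3 * (mu p * \<alpha> c a p) - 1 / 2 * ?Y a p) p"
      by (rule pd_cong[OF _ _ p]) (simp_all add: pd_mu smooth_intros smooth_mu smooth_\<alpha> smooth_Y_low)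
    also have "\<dots> = - 3 * (pd c b mu p * \<alpha> c a p + mu p * pd c b (\<alpha> c a) p) - pd c b (?Y a) p / 2"
      by (simp only: pd_diff pd_mult pd_const smooth_intros smooth_mu smooth_\<alpha> smooth_Y_low p)
        (simp add: algebra_simps)
    finally show ?thesis .
  qed
  have m: "2 * (mu p * ?E) = pd c 1 (\<alpha> c 2) p - pd c 2 (\<alpha> c 1) p"
    using nonzero_\<epsilon>[OF p] by (simp add: mu_def)
  have Y: "Y_up \<Gamma> \<epsilon> c 1 p * ?E = ?Y 2 p" "Y_up \<Gamma> \<epsilon> c 2 p * ?E = - ?Y 1 p"
    using nonzero_\<epsilon>[OF p] by (simp_all add: Y_up_eq[OF p])
  have "(12 * (Y_up \<Gamma> \<epsilon> c 1 p * \<alpha> c 1 p + Y_up \<Gamma> \<epsilon> c 2 p * \<alpha> c 2 p)) * ?E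
      = (- 2 * phi \<Gamma> \<epsilon> c p - 48 * (mu p)\<^sup>2) * ?E"
    using pd_commute[OF smooth_mu p, of 1 2] Y m phi_eq[OF p]
    unfolding dd pd_mu[OF p] by algebra
  then show ?thesis using nonzero_\<epsilon>[OF p] unfolding mult_cancel_right by simp
qed

end

section \<open>Differentiation along the Cotton-York field\<close>

context special_chart
begin

definition D :: "('a \<Rightarrow> real) \<Rightarrow> 'a \<Rightarrow> real" where
  "D F p = Y_up \<Gamma> \<epsilon> c 1 p * pd c 1 F p + Y_up \<Gamma> \<epsilon> c 2 p * pd c 2 F p"

lemma along_eq_D: "along (Y_up \<Gamma> \<epsilon>) F c = D (F c)"
  by (simp add: along_def D_def sum_2 fun_eq_iff)

lemma smooth_D: "smooth_in c F \<Longrightarrow> smooth_in c (D F)"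
  unfolding D_def[abs_def] by (intro smooth_intros smooth_Y_up)

lemma D_cong: "smooth_in c G \<Longrightarrow> (\<And>p. p \<in> domain c \<Longrightarrow> F p = G p) \<Longrightarrow> p \<in> domain c \<Longrightarrow> D F p = D G p"
  using pd_cong[where F = F and G = G and p = p] by (simp only: D_def)

lemma
  assumes "smooth_in c F" "smooth_in c G" "p \<in> domain c"
  shows D_add: "D (\<lambda>p. F p + G p) p = D F p + D G p"
    and D_diff: "D (\<lambda>p. F p - G p) p = D F p - D G p"
    and D_mult: "D (\<lambda>p. F p * G p) p = F p * D G p + D F p * G p"
  using assms by (simp_all add: D_def pd_add pd_diff pd_mult algebra_simps)

lemma D_const: "D (\<lambda>_. r) p = 0"
  by (simp add: D_def)

end

locale degenerate_chart = special_chart c \<Gamma> \<epsilon>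
  for c :: "('a, 2) chart" and \<Gamma> :: "('a, 2) tensor3" and \<epsilon> :: "('a, 2) tensor2" +
  assumes Y_nonzero: "p \<in> domain c \<Longrightarrow> \<exists>a. Y_low \<Gamma> \<epsilon> c a p \<noteq> 0"
    and rho_zero: "p \<in> domain c \<Longrightarrow> rho \<Gamma> \<epsilon> c p = 0"
begin

abbreviation "Y \<equiv> Y_up \<Gamma> \<epsilon> c"
abbreviation "W \<equiv> W_up \<Gamma> \<epsilon> c"
abbreviation "f \<equiv> f_fun \<Gamma> \<epsilon> c"
abbreviation "h \<equiv> h_fun \<Gamma> \<epsilon> c"
abbreviation "k \<equiv> k_fun \<Gamma> \<epsilon> c"
abbreviation "m \<equiv> m_fun \<Gamma> \<epsilon> c"
abbreviation "\<phi> \<equiv> phi \<Gamma> \<epsilon> c"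

lemma Y_up_nonzero:
  assumes p: "p \<in> domain c"
  shows "(Y 1 p)\<^sup>2 + (Y 2 p)\<^sup>2 \<noteq> 0"
proof -
  obtain a where "Y_low \<Gamma> \<epsilon> c a p \<noteq> 0" using Y_nonzero[OF p] by blast
  then have "Y_low \<Gamma> \<epsilon> c 1 p \<noteq> 0 \<or> Y_low \<Gamma> \<epsilon> c 2 p \<noteq> 0"
    using exhaust_2[of a] by auto
  then show ?thesis
    using nonzero_\<epsilon>[OF p] by (auto simp: Y_up_eq[OF p] sum_power2_eq_zero_iff)
qed

text \<open>Up to the factor \<open>\<epsilon>\<^sub>1\<^sub>2\<close>, \<open>\<rho>\<close> is the determinant of \<open>Y\<close> and \<open>W\<close>, so \<open>W\<close> is a multiple of the
  nonzero vector \<open>Y\<close>. The factor is found by taking the coordinate inner product with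
  \<open>Y\<close>. This expression is defined, and smooth, on the whole chart, whereas a quotient of two
  components need not be.\<close>

lemma
  assumes p: "p \<in> domain c"
  shows f_eq: "f p = (W 1 p * Y 1 p + W 2 p * Y 2 p) / ((Y 1 p)\<^sup>2 + (Y 2 p)\<^sup>2)"
    and W_eq: "W a p = f p * Y a p"
proof -
  let ?n = "(Y 1 p)\<^sup>2 + (Y 2 p)\<^sup>2"
  let ?r = "(W 1 p * Y 1 p + W 2 p * Y 2 p) / ?n"
  have "Y_low \<Gamma> \<epsilon> c 1 p = - (\<epsilon> c 1 2 p * Y 2 p)" "Y_low \<Gamma> \<epsilon> c 2 p = \<epsilon> c 1 2 p * Y 1 p"
    using nonzero_\<epsilon>[OF p] by (simp_all add: Y_up_eq[OF p])
  then have "\<epsilon> c 1 2 p * (Y 1 p * W 2 p - Y 2 p * W 1 p) = 0"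
    using rho_zero[OF p] by (simp add: rho_def sum_2 algebra_simps)
  then have dep: "Y 1 p * W 2 p = Y 2 p * W 1 p"
    using nonzero_\<epsilon>[OF p] by simp
  have "W 1 p * ?n = (W 1 p * Y 1 p + W 2 p * Y 2 p) * Y 1 p"
    "W 2 p * ?n = (W 1 p * Y 1 p + W 2 p * Y 2 p) * Y 2 p"
    using dep by algebra+
  then have r: "\<forall>a. W a p = ?r * Y a p"
    using Y_up_nonzero[OF p] unfolding forall_2
    by (simp only: times_divide_eq_left eq_divide_eq if_False if_True simp_thms)
  have "f p = ?r"
    unfolding f_fun_def
  proof (rule the_equality)
    show "\<forall>a. W a p = ?r * Y a p" by (fact r)
  next
    fix s assume s: "\<forall>a. W a p = s * Y a p"
    then have "W 1 p * Y 1 p + W 2 p * Y 2 p = s * ?n"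
      by (simp add: algebra_simps power2_eq_square)
    then show "s = ?r" using Y_up_nonzero[OF p] by simp
  qed
  then show "f p = ?r" .
  show "W a p = f p * Y a p"
    unfolding \<open>f p = ?r\<close> using r by (rule spec)
qed

lemma smooth_f: "smooth_in c f"
  by (rule smooth_in_cong[OF _ f_eq])
    (intro smooth_intros smooth_Y_up smooth_W_up Y_up_nonzero, assumption)

lemma smooth_h: "smooth_in c h"
  unfolding h_fun_def[abs_def] ell_def sum_2 along_eq_D
  by (intro smooth_intros smooth_D smooth_f smooth_phi smooth_rho_tensor smooth_Y_up) simp_all

lemma smooth_k: "smooth_in c k"
  unfolding k_fun_def[abs_def] along_eq_D
  by (intro smooth_intros smooth_D smooth_f smooth_phi smooth_h) simp_all

text \<open>The equation \<open>Y\<^sup>b \<nabla>\<^sub>b Y\<^sup>a = (f + 2 \<phi> / 3) Y\<^sup>a\<close>, solved for the partial derivatives.\<close>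

lemma D_Y:
  assumes p: "p \<in> domain c"
  shows "D (Y a) p = (f p + 2 / 3 * \<phi> p) * Y a p
    - (\<Gamma> c a 1 1 p * (Y 1 p)\<^sup>2 + 2 * \<Gamma> c a 1 2 p * Y 1 p * Y 2 p + \<Gamma> c a 2 2 p * (Y 2 p)\<^sup>2)"
  using W_eq[OF p, of a] sym_\<Gamma>[OF p, of a 2 1]
  by (simp add: D_def W_up_def nabla_vec_def sum_2 algebra_simps power2_eq_square)

end

section \<open>The constraints on the square of the curvature\<close>

locale degenerate_pEW_chart = degenerate_chart c \<Gamma> \<epsilon> + pEW_chart c \<Gamma> \<epsilon> \<alpha>
  for c :: "('a, 2) chart" and \<Gamma> :: "('a, 2) tensor3" and \<epsilon> :: "('a, 2) tensor2"
    and \<alpha> :: "('a, 2) tensor1"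
begin

abbreviation t :: "'a \<Rightarrow> real" where "t p \<equiv> (mu p)\<^sup>2"

lemmas smooths = smooth_mu smooth_f smooth_h smooth_k smooth_phi smooth_\<alpha> smooth_Y_up

text \<open>Along \<open>Y\<close> the inhomogeneous term of the derivative of \<open>\<mu>\<close> drops out, as \<open>Y\<^sup>a Y\<^sub>a = 0\<close>, and
  \<open>Y\<^sup>a \<alpha>\<^sub>a\<close> is known in terms of \<open>t\<close>.\<close>

lemma D_t:
  assumes p: "p \<in> domain c"
  shows "D t p = \<phi> p * t p + 24 * (t p)\<^sup>2"
proof -
  have YY: "Y 1 p * Y_low \<Gamma> \<epsilon> c 1 p + Y 2 p * Y_low \<Gamma> \<epsilon> c 2 p = 0"
    by (simp add: Y_up_eq[OF p])
  have "D mu p = - 3 * mu p * (Y 1 p * \<alpha> c 1 p + Y 2 p * \<alpha> c 2 p)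
      - (Y 1 p * Y_low \<Gamma> \<epsilon> c 1 p + Y 2 p * Y_low \<Gamma> \<epsilon> c 2 p) / 2"
    by (simp add: D_def pd_mu[OF p] algebra_simps)
  also have "\<dots> = - 3 * mu p * (- \<phi> p / 6 - 4 * t p)"
    unfolding YY Y_\<alpha>[OF p] by simp
  finally have "D mu p = \<dots>" .
  moreover have "D t p = 2 * mu p * D mu p"
    using D_mult[OF smooth_mu smooth_mu p] by (simp add: power2_eq_square)
  ultimately show ?thesis by (simp add: power2_eq_square algebra_simps)
qed

text \<open>The function \<open>s = Y\<^sup>a \<alpha>\<^sub>a\<close> is differentiated along \<open>Y\<close> in two ways: by the pEW equation and
  the proportionality of \<open>Y\<^sup>b \<nabla>\<^sub>b Y\<^sup>a\<close> to \<open>Y\<^sup>a\<close>, which give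
  \<open>(f + 2 \<phi> / 3) s - s\<^sup>2 - P\<^sub>a\<^sub>b Y\<^sup>a Y\<^sup>b\<close>, and by its expression \<open>- \<phi> / 6 - 4 t\<close>.\<close>

lemma h_eq:
  assumes p: "p \<in> domain c"
  shows "h p = 240 * (t p)\<^sup>2 - 12 * f p * t p"
proof -
  let ?P = "\<lambda>a b. rho_tensor \<Gamma> c a b p"
  let ?s = "Y 1 p * \<alpha> c 1 p + Y 2 p * \<alpha> c 2 p"
  let ?PYY = "?P 1 1 * Y 1 p * Y 1 p + ?P 1 2 * Y 1 p * Y 2 p + ?P 2 1 * Y 2 p * Y 1 p + ?P 2 2 * Y 2 p * Y 2 p"
  note e = \<epsilon>_components[OF p]
  have "D (\<lambda>p. Y 1 p * \<alpha> c 1 p + Y 2 p * \<alpha> c 2 p) p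
      = Y 1 p * D (\<alpha> c 1) p + D (Y 1) p * \<alpha> c 1 p + (Y 2 p * D (\<alpha> c 2) p + D (Y 2) p * \<alpha> c 2 p)"
    by (simp only: D_add D_mult smooth_intros smooths p)
  also have "\<dots> = (f p + 2 / 3 * \<phi> p) * ?s - ?s\<^sup>2 - ?PYY"
    unfolding D_Y[OF p] D_def[of "\<alpha> c _"] pd_\<alpha>[OF p] e sym_\<Gamma>[OF p, of _ 2 1] by algebra
  finally have 1: "D (\<lambda>p. Y 1 p * \<alpha> c 1 p + Y 2 p * \<alpha> c 2 p) p = \<dots>" .
  have "D (\<lambda>p. Y 1 p * \<alpha> c 1 p + Y 2 p * \<alpha> c 2 p) p = D (\<lambda>p. (-1/6) * \<phi> p - 4 * t p) p"
    by (rule D_cong[OF _ _ p]) (simp_all add: Y_\<alpha> smooth_intros smooths)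
  also have "\<dots> = (-1/6) * D \<phi> p - 4 * D t p"
    by (simp only: D_diff D_mult D_const smooth_intros smooths p)
  finally have 2: "D (\<lambda>p. Y 1 p * \<alpha> c 1 p + Y 2 p * \<alpha> c 2 p) p = \<dots>" .
  have "h p = 5 * (\<phi> p)\<^sup>2 / 12 + 3 * ?PYY - D \<phi> p / 2 + f p * \<phi> p / 2"
    by (simp add: h_fun_def ell_def sum_2 along_eq_D algebra_simps)
  with 1 2 show ?thesis
    unfolding Y_\<alpha>[OF p] D_t[OF p] by (simp add: field_simps power2_eq_square)
qed

text \<open>The derivative of the quadratic equation along \<open>Y\<close> is cubic in \<open>t\<close>; replacing \<open>240 t\<^sup>2\<close> by
  \<open>h + 12 f t\<close> twice makes it linear. The functions \<open>k\<close> and \<open>m\<close> are the coefficients that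
  result.\<close>

lemma m_eq:
  assumes p: "p \<in> domain c"
  shows "m p = - 4 * t p * k p"
proof -
  have "D h p = D (\<lambda>p. 240 * (t p * t p) - 12 * (f p * t p)) p"
    by (rule D_cong[OF _ _ p]) (simp_all add: h_eq smooth_intros smooths power2_eq_square)
  also have "\<dots> = 240 * (2 * t p * D t p) - 12 * (f p * D t p + D f p * t p)"
    by (simp only: D_diff D_mult D_const smooth_intros smooths p) simp
  finally show ?thesis
    unfolding m_fun_def k_fun_def along_eq_D h_eq[OF p] D_t[OF p] by algebra
qed

text \<open>In \<open>k D m\<close> the derivative of \<open>t\<close> produces \<open>- 4 k\<^sup>2 (\<phi> t + 24 t\<^sup>2)\<close>. The relation \<open>m = - 4 t k\<close>
  turns this into \<open>m (k \<phi> - 6 m)\<close>, which explains the factor \<open>k\<close> and the constant \<open>6\<close> in the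
  obstruction.\<close>

theorem obstruction_vanishes:
  assumes p: "p \<in> domain c"
  shows "k p * D m p - m p * (D k p + k p * \<phi> p - 6 * m p) = 0"
proof -
  have "D m p = D (\<lambda>p. - 4 * (t p * k p)) p"
    by (rule D_cong[OF _ _ p]) (simp_all add: m_eq smooth_intros smooths)
  also have "\<dots> = - 4 * (t p * D k p + D t p * k p)"
    by (simp only: D_mult D_const smooth_intros smooths p)
  finally show ?thesis
    unfolding m_eq[OF p] D_t[OF p] by algebra
qed

end

section \<open>The obstruction on the surface\<close>

theorem theorem3p3:
  fixes M :: "'a topology" and A :: "('a, 2) chart set"
    and \<P> :: "('a, 2) tensor3 set" and \<Gamma> :: "('a, 2) tensor3"
    and \<epsilon> :: "('a, 2) tensor2" and \<alpha> :: "('a, 2) tensor1"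
  assumes "smooth_manifold M A"
    and "projective_structure A \<P>"
    and "volume_form A \<epsilon>"
    and "\<Gamma> \<in> \<P>"
    and "\<forall>c\<in>A. \<forall>p\<in>domain c. \<forall>a b d. nabla_cov2 \<Gamma> \<epsilon> c a b d p = 0"
    and "\<forall>c\<in>A. \<forall>p\<in>domain c. \<exists>a. Y_low \<Gamma> \<epsilon> c a p \<noteq> 0"
    and "\<forall>c\<in>A. \<forall>p\<in>domain c. rho \<Gamma> \<epsilon> c p = 0"
    and "pEW A \<Gamma> \<alpha>"
  shows "\<forall>c\<in>A. \<forall>p\<in>domain c.
    k_fun \<Gamma> \<epsilon> c p * along (Y_up \<Gamma> \<epsilon>) (m_fun \<Gamma> \<epsilon>) c p
    - m_fun \<Gamma> \<epsilon> c p * (along (Y_up \<Gamma> \<epsilon>) (k_fun \<Gamma> \<epsilon>) c p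
        + k_fun \<Gamma> \<epsilon> c p * phi \<Gamma> \<epsilon> c p - 6 * m_fun \<Gamma> \<epsilon> c p) = 0"
proof (intro ballI)
  fix c p assume c: "c \<in> A" and p: "p \<in> domain c"
  have \<Gamma>: "torsion_free_connection A \<Gamma>"
    using assms(2,4) by (auto simp: projective_structure_def projective_rel_def quotient_def)
  have chart: "open (coord c ` domain c)" "inj_on (coord c) (domain c)"
  proof -
    have M: "openin M (domain c)" "open (coord c ` domain c)"
      "homeomorphic_map (subtopology M (domain c)) (top_of_set (coord c ` domain c)) (coord c)"
      using assms(1) c by (auto simp: smooth_manifold_def)
    from M(2) show "open (coord c ` domain c)" .
    have "topspace (subtopology M (domain c)) = domain c"
      using openin_subset[OF M(1)] by auto
    then show "inj_on (coord c) (domain c)"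
      using M(3) by (metis homeomorphic_imp_injective_map)
  qed
  have \<epsilon>: "two_form A \<epsilon>" "\<exists>a b. \<epsilon> c a b q \<noteq> 0" if "q \<in> domain c" for q
    using assms(3) c that by (auto simp: volume_form_def)
  have skew: "\<epsilon> c a b q = - \<epsilon> c b a q" if "q \<in> domain c" for a b q
    using \<epsilon>(1)[OF that] c that unfolding two_form_def by blast
  have nonzero: "\<epsilon> c 1 2 q \<noteq> 0" if q: "q \<in> domain c" for q
  proof
    assume "\<epsilon> c 1 2 q = 0"
    then have "\<epsilon> c a b q = 0" for a b
      using skew[OF q, of 1 1] skew[OF q, of 2 2] skew[OF q, of 2 1] exhaust_2[of a] exhaust_2[of b]
      by auto
    with \<epsilon>(2)[OF q] show False by blast
  qed
  interpret degenerate_pEW_chart c \<Gamma> \<epsilon> \<alpha>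
  proof
    show "open (coord c ` domain c)" "inj_on (coord c) (domain c)"
      by (fact chart)+
    show "smooth_in c (\<Gamma> c k a b)" for k a b
      using \<Gamma> c unfolding torsion_free_connection_def by blast
    show "\<Gamma> c k a b q = \<Gamma> c k b a q" if "q \<in> domain c" for q k a b
      using \<Gamma> c that unfolding torsion_free_connection_def by blast
    show "smooth_in c (\<epsilon> c a b)" for a b
      using \<epsilon>(1)[OF p] c unfolding two_form_def by blast
    show "\<epsilon> c a b q = - \<epsilon> c b a q" if "q \<in> domain c" for q a b
      by (fact skew[OF that])
    show "\<epsilon> c 1 2 q \<noteq> 0" if "q \<in> domain c" for q
      by (fact nonzero[OF that])
    show "nabla_cov2 \<Gamma> \<epsilon> c a b d q = 0" if "q \<in> domain c" for q a b d
      using assms(5) c that by blast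
    show "\<exists>a. Y_low \<Gamma> \<epsilon> c a q \<noteq> 0" if "q \<in> domain c" for q
      using assms(6) c that by blast
    show "rho \<Gamma> \<epsilon> c q = 0" if "q \<in> domain c" for q
      using assms(7) c that by blast
    show "smooth_in c (\<alpha> c a)" for a
      using assms(8) c unfolding pEW_def one_form_def by blast
    show "(nabla_form \<Gamma> \<alpha> c a b q + nabla_form \<Gamma> \<alpha> c b a q) / 2 + \<alpha> c a q * \<alpha> c b q
        + (rho_tensor \<Gamma> c a b q + rho_tensor \<Gamma> c b a q) / 2 = 0" if "q \<in> domain c" for q a b
      using assms(8) c that unfolding pEW_def by blast
  qed
  show "k_fun \<Gamma> \<epsilon> c p * along (Y_up \<Gamma> \<epsilon>) (m_fun \<Gamma> \<epsilon>) c p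
    - m_fun \<Gamma> \<epsilon> c p * (along (Y_up \<Gamma> \<epsilon>) (k_fun \<Gamma> \<epsilon>) c p
        + k_fun \<Gamma> \<epsilon> c p * phi \<Gamma> \<epsilon> c p - 6 * m_fun \<Gamma> \<epsilon> c p) = 0"
    unfolding along_eq_D by (rule obstruction_vanishes[OF p])
qed

end
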